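(* Let $k\leq n$ be positive integers. Let $\chi:\mathbb{N}^n\times I_{n,k}\to \mathbb{R}$ be a $k$-transitive function and let $W\subseteq \mathbb{N}^n$ be a finite nonempty $\mathfrak{S}_n$-invariant set of words. Then (a) $\mathbb{E}_W[f_\chi]=\binom{n}{k}\mathbb{E}_W[\chi_1]$, (b) $\mathbb{E}_W[g_\chi]=(n-k+1)\mathbb{E}_W[\chi_1]$, and (c) $\mathbb{E}_W[f_\chi]=\frac{1}{k}\binom{n}{k-1}\mathbb{E}_W[g_\chi]$.
   Context: $\mathbb{N}=\{1,2,\dots\}$ and $I_{n,k}=\{(i_1,\dots,i_k)\mid 1\le i_1<\cdots<i_k\le n\}$. A function $\chi:\mathbb{N}^n\times I_{n,k}\to\mathbb{R}$ is $k$-transitive if there is a function $\theta:\mathbb{N}^k\to\mathbb{R}$ with $\chi(w,(i_1,\dots,i_k))=\theta(w_{i_1},\dots,w_{i_k})$ for all $w\in\mathbb{N}^n$ and $(i_1,\dots,i_k)\in I_{n,k}$. A set $W\subseteq\mathbb{N}^n$ is $\mathfrak{S}_n$-invariant if $(w_{\sigma^{-1}(1)},\dots,w_{\sigma^{-1}(n)})\in W$ for all $w\in W$, $\sigma\in\mathfrak{S}_n$. Define $f_\chi(w)=\sum_{\mathbf{p}\in I_{n,k}}\chi(w,\mathbf{p})$, $g_\chi(w)=\sum_{i=0}^{n-k}\chi(w,(1+i,2+i,\dots,k+i))$, and $\chi_1(w)=\chi(w,(1,2,\dots,k))$. For a finite set $W$ and $f:W\to\mathbb{R}$, $\mathbb{E}_W[f]=\frac1{|W|}\sum_{w\in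 W}f(w)$. *)

theory Defs
  imports Complex_Main "HOL-Combinatorics.Permutations"
begin

(* Tuples are lists. The paper's natural numbers start at 1, so the letters of a word
   are positive, and positions in a word are counted from 1 (list positions from 0). *)

definition words :: "nat \<Rightarrow> nat list set" where
  "words n = {w. length w = n \<and> (\<forall>a\<in>set w. 1 \<le> a)}"

definition letter :: "nat list \<Rightarrow> nat \<Rightarrow> nat" where
  "letter w i = w ! (i - 1)"

definition index_tuples :: "nat \<Rightarrow> nat \<Rightarrow> nat list set" where
  "index_tuples n k = {p. length p = k \<and> set p \<subseteq> {1..n} \<and> sorted_wrt (<) p}"

lemma finite_index_tuples: "finite (index_tuples n k)"
  by (rule finite_subset[OF _ finite_lists_length_eq[of "{1..n}" k]])
     (auto simp: index_tuples_def)

(* A function on N^n x I_{n,k} is a total function of two lists. All definitions below use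
   only its values on words n and index_tuples n k (for 1 <= k <= n). *)

definition k_transitive :: "nat \<Rightarrow> nat \<Rightarrow> (nat list \<Rightarrow> nat list \<Rightarrow> real) \<Rightarrow> bool" where
  "k_transitive n k \<chi> \<longleftrightarrow>
     (\<exists>\<theta> :: nat list \<Rightarrow> real. \<forall>w \<in> words n. \<forall>p \<in> index_tuples n k.
        \<chi> w p = \<theta> (map (letter w) p))"

definition permute_word :: "nat \<Rightarrow> (nat \<Rightarrow> nat) \<Rightarrow> nat list \<Rightarrow> nat list" where
  "permute_word n \<sigma> w = map (\<lambda>i. letter w (inv \<sigma> i)) [1..<n + 1]"

definition sym_invariant :: "nat \<Rightarrow> nat list set \<Rightarrow> bool" where
  "sym_invariant n W \<longleftrightarrow> (\<forall>w \<in> W. \<forall>\<sigma>. \<sigma> permutes {1..n} \<longrightarrow> permute_word n \<sigma> w \<in> W)"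

definition f_stat :: "nat \<Rightarrow> nat \<Rightarrow> (nat list \<Rightarrow> nat list \<Rightarrow> real) \<Rightarrow> nat list \<Rightarrow> real" where
  "f_stat n k \<chi> w = (\<Sum>p \<in> index_tuples n k. \<chi> w p)"

definition g_stat :: "nat \<Rightarrow> nat \<Rightarrow> (nat list \<Rightarrow> nat list \<Rightarrow> real) \<Rightarrow> nat list \<Rightarrow> real" where
  "g_stat n k \<chi> w = (\<Sum>i = 0..n - k. \<chi> w [1 + i..<k + i + 1])"

definition first_stat :: "nat \<Rightarrow> (nat list \<Rightarrow> nat list \<Rightarrow> real) \<Rightarrow> nat list \<Rightarrow> real" where
  "first_stat k \<chi> w = \<chi> w [1..<k + 1]"

definition avg :: "'a set \<Rightarrow> ('a \<Rightarrow> real) \<Rightarrow> real" where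
  "avg W f = 1 / real (card W) * (\<Sum>w \<in> W. f w)"

end

theory Submission
  imports Defs
begin

text \<open>
  Averaged over a permutation-invariant set of words, no position tuple is distinguished: a
  permutation \<open>\<sigma>\<close> of the positions that carries \<open>(1, \<dots>, k)\<close> to a given tuple \<open>p\<close> of
  distinct positions induces a bijection of \<open>W\<close>, and the bijection carries the letters at \<open>p\<close> to
  the letters at \<open>(1, \<dots>, k)\<close>. Transitivity says that \<open>\<chi>\<close> sees nothing but those letters, so
  the total of \<open>\<chi>\<close> over \<open>W\<close> is the same at every tuple
  (\<open>sum_letters_at_eq_sum_prefix\<close>). By linearity, averaging a sum of \<open>\<chi>\<close> over a set of tuples
  amounts to counting the tuples: there are \<open>n choose k\<close> of them in the first statistic and
  \<open>n - k + 1\<close> in the second. The third identity compares the two counts by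
  \<open>k * (n choose k) = (n - k + 1) * (n choose (k - 1))\<close>.
\<close>

text \<open>
  The positions after the prefix and the positions outside \<open>p\<close> are equally many; any bijection
  between them completes the prescribed values to a permutation.
\<close>

lemma exists_permutation_extending_tuple:
  fixes p :: "nat list"
  assumes "distinct p" and "set p \<subseteq> {1..n}"
  obtains \<sigma> where "\<sigma> permutes {1..n}" and "map \<sigma> [1..<length p + 1] = p"
proof -
  let ?k = "length p"
  have card_p: "card (set p) = ?k"
    using assms(1) by (rule distinct_card)
  then have "?k \<le> n"
    using card_mono[OF _ assms(2)] by simp
  then have "card ({1..n} - {1..?k}) = card ({1..n} - set p)"
    using assms(2) card_p by (simp add: card_Diff_subset)
  then obtain h where h: "bij_betw h ({1..n} - {1..?k}) ({1..n} - set p)"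
    using finite_same_card_bij by blast
  define \<sigma> where
    "\<sigma> i = (if i \<in> {1..?k} then p ! (i - 1) else if i \<in> {1..n} then h i else i)" for i
  have "bij_betw (\<lambda>i. i - 1) {1..?k} {..<?k}"
    by (rule bij_betw_byWitness[where f' = Suc]) auto
  then have "bij_betw (\<lambda>i. p ! (i - 1)) {1..?k} (set p)"
    using bij_betw_trans[OF _ bij_betw_nth[OF assms(1) refl refl]] by (simp add: o_def)
  then have prefix: "bij_betw \<sigma> {1..?k} (set p)"
    by (rule bij_betw_cong[THEN iffD1, rotated]) (simp add: \<sigma>_def)
  have rest: "bij_betw \<sigma> ({1..n} - {1..?k}) ({1..n} - set p)"
    using h by (rule bij_betw_cong[THEN iffD1, rotated]) (simp add: \<sigma>_def)
  have "bij_betw \<sigma> ({1..?k} \<union> ({1..n} - {1..?k})) (set p \<union> ({1..n} - set p))"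
    using prefix rest by (rule bij_betw_combine) blast
  moreover have "{1..?k} \<union> ({1..n} - {1..?k}) = {1..n}"
    using \<open>?k \<le> n\<close> by auto
  moreover have "set p \<union> ({1..n} - set p) = {1..n}"
    using assms(2) by auto
  ultimately have "bij_betw \<sigma> {1..n} {1..n}"
    by simp
  then have "\<sigma> permutes {1..n}"
    by (rule bij_imp_permutes) (use \<open>?k \<le> n\<close> in \<open>auto simp: \<sigma>_def\<close>)
  moreover have "map \<sigma> [1..<?k + 1] = p"
    by (rule nth_equalityI) (auto simp: \<sigma>_def simp del: upt_Suc)
  ultimately show thesis
    by (rule that)
qed

lemma letter_permute_word:
  assumes "i \<in> {1..n}"
  shows "letter (permute_word n \<sigma> w) i = letter w (inv \<sigma> i)"
  using assms by (auto simp: permute_word_def letter_def simp del: upt_Suc)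

lemma words_eqI:
  assumes "v \<in> words n" and "w \<in> words n"
    and letters: "\<And>i. i \<in> {1..n} \<Longrightarrow> letter v i = letter w i"
  shows "v = w"
proof (rule nth_equalityI)
  show "length v = length w"
    using assms by (simp add: words_def)
next
  fix i assume "i < length v"
  then show "v ! i = w ! i"
    using letters[of "Suc i"] assms(1) by (simp add: letter_def words_def)
qed

text \<open>
  Invariance gives only that \<open>W\<close> is mapped into itself; as \<open>W\<close> is finite, injectivity suffices.
\<close>

lemma bij_betw_permute_word:
  assumes "W \<subseteq> words n" and "finite W" and "sym_invariant n W" and "\<sigma> permutes {1..n}"
  shows "bij_betw (permute_word n \<sigma>) W W"
proof -
  have maps: "permute_word n \<sigma> ` W \<subseteq> W"
    using assms(3,4) by (auto simp: sym_invariant_def)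
  have "inj_on (permute_word n \<sigma>) W"
  proof (rule inj_onI)
    fix v w
    assume "v \<in> W" "w \<in> W" and eq: "permute_word n \<sigma> v = permute_word n \<sigma> w"
    show "v = w"
    proof (rule words_eqI)
      fix i assume "i \<in> {1..n}"
      then have "\<sigma> i \<in> {1..n}"
        using permutes_in_image[OF assms(4)] by blast
      then show "letter v i = letter w i"
        using arg_cong[OF eq, of "\<lambda>u. letter u (\<sigma> i)"]
        by (simp only: letter_permute_word permutes_inverses(2)[OF assms(4)])
    qed (use \<open>v \<in> W\<close> \<open>w \<in> W\<close> assms(1) in auto)
  qed
  then show ?thesis
    using maps assms(2) by (simp add: bij_betw_def endo_inj_surj)
qed

text \<open>
  Reading a word at \<open>p\<close> is the same as moving the letters at \<open>p\<close> to the front and reading a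
  prefix, and this move only permutes the words of \<open>W\<close>. The word \<open>permute_word n \<tau> w\<close> has at
  position \<open>\<tau> j\<close> the letter that \<open>w\<close> has at \<open>j\<close>; so \<open>\<tau>\<close> must be the inverse of a
  permutation that carries the first positions to \<open>p\<close>.
\<close>

lemma sum_letters_at_eq_sum_prefix:
  fixes \<theta> :: "nat list \<Rightarrow> 'a::comm_monoid_add"
  assumes "W \<subseteq> words n" and "finite W" and "sym_invariant n W"
    and "distinct p" and "set p \<subseteq> {1..n}"
  shows "(\<Sum>w\<in>W. \<theta> (map (letter w) p)) = (\<Sum>w\<in>W. \<theta> (map (letter w) [1..<length p + 1]))"
proof -
  obtain \<sigma> where \<sigma>: "\<sigma> permutes {1..n}" and p: "map \<sigma> [1..<length p + 1] = p"
    using exists_permutation_extending_tuple[OF assms(4,5)] .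
  have "length p \<le> n"
    using card_mono[OF _ assms(5)] distinct_card[OF assms(4)] by simp
  have read: "map (letter (permute_word n (inv \<sigma>) w)) [1..<length p + 1] = map (letter w) p" for w
  proof -
    have "map (letter (permute_word n (inv \<sigma>) w)) [1..<length p + 1]
        = map (letter w \<circ> \<sigma>) [1..<length p + 1]"
      using \<open>length p \<le> n\<close>
      by (intro map_cong) (auto simp: letter_permute_word permutes_inv_inv[OF \<sigma>])
    also have "\<dots> = map (letter w) p"
      by (subst (2) p[symmetric]) (simp only: map_map)
    finally show ?thesis .
  qed
  have "bij_betw (permute_word n (inv \<sigma>)) W W"
    using assms(1,2,3) permutes_inv[OF \<sigma>] by (rule bij_betw_permute_word)
  from sum.reindex_bij_betw[OF this, of "\<lambda>w. \<theta> (map (letter w) [1..<length p + 1])"]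
  show ?thesis
    by (simp only: read)
qed

lemma card_index_tuples: "card (index_tuples n k) = n choose k"
proof -
  have [simp]: "finite A" if "A \<subseteq> {1..n}" for A
    using that by (rule finite_subset) simp
  have "bij_betw set (index_tuples n k) {A. A \<subseteq> {1..n} \<and> card A = k}"
    by (rule bij_betw_byWitness[where f' = sorted_list_of_set])
       (auto simp: index_tuples_def strict_sorted_iff distinct_card subset_iff
         sorted_list_of_set.idem_if_sorted_distinct)
  then show ?thesis
    by (simp add: bij_betw_same_card n_subsets)
qed

lemma interval_in_index_tuples:
  assumes "i \<le> n - k" and "k \<le> n"
  shows "[1 + i..<k + i + 1] \<in> index_tuples n k"
  using assms by (auto simp: index_tuples_def simp del: upt_Suc)

lemma sum_k_transitive_eq_sum_first_stat:
  assumes "k \<le> n" and "k_transitive n k \<chi>"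
    and "W \<subseteq> words n" and "finite W" and "sym_invariant n W"
    and "p \<in> index_tuples n k"
  shows "(\<Sum>w\<in>W. \<chi> w p) = (\<Sum>w\<in>W. first_stat k \<chi> w)"
proof -
  obtain \<theta> where \<theta>: "\<And>w q. w \<in> words n \<Longrightarrow> q \<in> index_tuples n k \<Longrightarrow> \<chi> w q = \<theta> (map (letter w) q)"
    using assms(2) unfolding k_transitive_def by blast
  have p: "distinct p" "set p \<subseteq> {1..n}" "length p = k"
    using assms(6) by (auto simp: index_tuples_def strict_sorted_iff)
  have prefix: "[1..<k + 1] \<in> index_tuples n k"
    using interval_in_index_tuples[of 0 n k] assms(1) by simp
  have "(\<Sum>w\<in>W. \<chi> w p) = (\<Sum>w\<in>W. \<theta> (map (letter w) p))"
    using \<theta> assms(3,6) by (intro sum.cong) auto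
  also have "\<dots> = (\<Sum>w\<in>W. \<theta> (map (letter w) [1..<k + 1]))"
    using sum_letters_at_eq_sum_prefix[OF assms(3-5) p(1,2)] by (simp only: p(3))
  also have "\<dots> = (\<Sum>w\<in>W. first_stat k \<chi> w)"
    unfolding first_stat_def using \<theta>[OF _ prefix] assms(3) by (intro sum.cong) auto
  finally show ?thesis .
qed

lemma avg_sum_of_constant_total:
  assumes "\<And>i. i \<in> I \<Longrightarrow> (\<Sum>w\<in>W. F w i) = (\<Sum>w\<in>W. h w)"
  shows "avg W (\<lambda>w. \<Sum>i\<in>I. F w i) = real (card I) * avg W h"
proof -
  have "(\<Sum>w\<in>W. \<Sum>i\<in>I. F w i) = (\<Sum>i\<in>I. \<Sum>w\<in>W. F w i)"
    by (rule sum.swap)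
  also have "\<dots> = real (card I) * (\<Sum>w\<in>W. h w)"
    using assms by simp
  finally show ?thesis
    by (simp add: avg_def)
qed

lemma times_binomial_eq_times_binomial_pred:
  assumes "1 \<le> k" and "k \<le> n"
  shows "k * (n choose k) = (n - k + 1) * (n choose (k - 1))"
proof -
  have "k * (n choose k) = n * ((n - 1) choose (k - 1))"
    using assms(1) by (intro times_binomial_minus1_eq) simp
  also have "\<dots> = (n - (k - 1)) * (n choose (k - 1))"
    by (rule binomial_absorb_comp[symmetric])
  also have "n - (k - 1) = n - k + 1"
    using assms by simp
  finally show ?thesis .
qed

theorem theorem5p2:
  fixes n k :: nat
    and \<chi> :: "nat list \<Rightarrow> nat list \<Rightarrow> real"
    and W :: "nat list set"
  assumes "1 \<le> k" and "k \<le> n"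
    and "k_transitive n k \<chi>"
    and "W \<subseteq> words n" and "finite W" and "W \<noteq> {}"
    and "sym_invariant n W"
  shows "avg W (f_stat n k \<chi>) = real (n choose k) * avg W (first_stat k \<chi>)
    \<and> avg W (g_stat n k \<chi>) = (real n - real k + 1) * avg W (first_stat k \<chi>)
    \<and> avg W (f_stat n k \<chi>) = 1 / real k * real (n choose (k - 1)) * avg W (g_stat n k \<chi>)"
proof -
  note total = sum_k_transitive_eq_sum_first_stat[OF assms(2,3,4,5,7)]
  have f: "avg W (f_stat n k \<chi>) = real (n choose k) * avg W (first_stat k \<chi>)"
    unfolding f_stat_def card_index_tuples[symmetric]
    using total by (rule avg_sum_of_constant_total)
  have "avg W (g_stat n k \<chi>) = real (card {0..n - k}) * avg W (first_stat k \<chi>)"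
    unfolding g_stat_def
    by (intro avg_sum_of_constant_total total interval_in_index_tuples) (use assms(2) in auto)
  then have g: "avg W (g_stat n k \<chi>) = (real n - real k + 1) * avg W (first_stat k \<chi>)"
    using assms(2) by (simp add: of_nat_diff add.commute)
  have "real k * real (n choose k) = (real n - real k + 1) * real (n choose (k - 1))"
    using arg_cong[OF times_binomial_eq_times_binomial_pred[OF assms(1,2)], of real] assms(2)
    by (simp only: of_nat_mult of_nat_add of_nat_diff of_nat_1)
  then have "real (n choose k) = 1 / real k * real (n choose (k - 1)) * (real n - real k + 1)"
    using assms(1) by (simp add: field_simps)
  then have "avg W (f_stat n k \<chi>) = 1 / real k * real (n choose (k - 1)) * avg W (g_stat n k \<chi>)"
    unfolding f g by simp
  with f g show ?thesis
    by blast
qed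

end
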